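(* Let $\theta \in (0,1)$ and $s,t \in (0,1]$. Then there exist a uniformly discrete unbounded set $X \subseteq \mathbb{R}^2$ and non-empty disjoint open sets $I_s$ and $I_t$ in $G(2,1)$ such that (1) $\dim_{\mathrm{A}}^{\theta} P_V X = s$ for all $V \in I_s$, (2) $\dim_{\mathrm{A}}^{\theta} P_V X = t$ for all $V \in I_t$.
   Context: A set $X \subseteq \mathbb{R}^d$ is uniformly discrete if there exists $\delta>0$ such that $|x-y| \geq \delta$ for all distinct $x,y \in X$. $G(2,1)$ is the Grassmannian of $1$-dimensional linear subspaces $V \subseteq \mathbb{R}^2$ with its usual topology (induced by the acute angle between lines). $P_V \colon \mathbb{R}^2 \to V$ is orthogonal projection onto $V$, and $V$ is identified with $\mathbb{R}$. $B(x,R)$ is the closed ball with centre $x$ and radius $R$. $N_r(A)$ is the smallest number of closed balls of radius $r>0$ needed to cover the bounded set $A$. Assouad spectrum: for $X \subseteq \mathbb{R}^m$ and $\theta \in (0,1)$, $\dim_{\mathrm{A}}^\theta X$ is the infimum of all $\alpha \geq 0$ for which there exists a constant $C>0$ such that $N_{R^{1/\theta}}(X \cap B(x,R)) \leq C (R/R^{1/\theta})^\alpha$ for all $0<R<1$ and all $x \in X$. *)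

theory Defs
  imports "HOL-Analysis.Analysis"
begin

section \<open>Covering numbers and the Assouad spectrum\<close>

definition covering_number :: "real \<Rightarrow> 'a::metric_space set \<Rightarrow> nat" where
  "covering_number r A = (LEAST n. \<exists>F. finite F \<and> card F = n \<and> A \<subseteq> (\<Union>c\<in>F. cball c r))"

text \<open>The minimum defining \<^const>\<open>covering_number\<close> is over a non-empty set of numbers.\<close>

lemma covering_number_attained:
  fixes A :: "'a::euclidean_space set"
  assumes "bounded A" "r > 0"
  shows "\<exists>F. finite F \<and> card F = covering_number r A \<and> A \<subseteq> (\<Union>c\<in>F. cball c r)"
proof -
  have "compact (closure A)"
    using assms by (simp add: compact_closure)
  then obtain F where F: "finite F" "closure A \<subseteq> (\<Union>c\<in>F. ball c r)"
    using assms(2) compact_eq_totally_bounded[of "closure A"] by blast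
  have "A \<subseteq> (\<Union>c\<in>F. cball c r)"
    using F(2) closure_subset[of A] ball_subset_cball by blast
  then have "\<exists>n F. finite F \<and> card F = n \<and> A \<subseteq> (\<Union>c\<in>F. cball c r)"
    using F(1) by blast
  then show ?thesis
    unfolding covering_number_def by (rule LeastI_ex)
qed

text \<open>For \<open>X\<close> in a Euclidean space of dimension \<open>m\<close> the exponent \<open>\<alpha> = m\<close> is always
  admissible, so the real infimum is taken over a non-empty set bounded below by \<open>0\<close>.\<close>

definition assouad_spectrum :: "real \<Rightarrow> 'a::euclidean_space set \<Rightarrow> real" where
  "assouad_spectrum \<theta> X = Inf {\<alpha>. \<alpha> \<ge> 0 \<and> (\<exists>C>0. \<forall>R x. 0 < R \<and> R < 1 \<and> x \<in> X \<longrightarrow>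
     real (covering_number (R powr (1/\<theta>)) (X \<inter> cball x R)) \<le> C * (R / R powr (1/\<theta>)) powr \<alpha>)}"


section \<open>Lines in the plane and orthogonal projections onto them\<close>

definition G21 :: "(real^2) set set" where
  "G21 = {V. subspace V \<and> dim V = 1}"

text \<open>A choice of one of the two unit vectors spanning a line.\<close>

definition line_dir :: "(real^2) set \<Rightarrow> real^2" where
  "line_dir V = (SOME u. u \<in> V \<and> norm u = 1)"

text \<open>The value \<open>0\<close> outside \<^const>\<open>G21\<close> is there because \<^locale>\<open>Metric_space\<close> requires
  symmetry and non-negativity on the whole type.\<close>

definition acute_angle :: "(real^2) set \<Rightarrow> (real^2) set \<Rightarrow> real" where
  "acute_angle V W = (if V \<in> G21 \<and> W \<in> G21 then arccos \<bar>line_dir V \<bullet> line_dir W\<bar> else 0)"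

definition G21_topology :: "(real^2) set topology" where
  "G21_topology = Metric_space.mtopology G21 acute_angle"

definition orth_proj :: "(real^2) set \<Rightarrow> real^2 \<Rightarrow> real^2" where
  "orth_proj V x = (THE p. p \<in> V \<and> (\<forall>v\<in>V. (x - p) \<bullet> v = 0))"

text \<open>The identification of a line with \<open>\<real>\<close>; the opposite choice of unit vector changes it by
  a sign only.\<close>

definition line_coord :: "(real^2) set \<Rightarrow> real^2 \<Rightarrow> real" where
  "line_coord V p = p \<bullet> line_dir V"

definition proj_real :: "(real^2) set \<Rightarrow> real^2 \<Rightarrow> real" where
  "proj_real V x = line_coord V (orth_proj V x)"


section \<open>Consistency of the definitions\<close>

lemma line_dir:
  assumes "V \<in> G21"
  shows "line_dir V \<in> V" "norm (line_dir V) = 1" "V = span {line_dir V}"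
proof -
  have V: "subspace V" "dim V = 1"
    using assms by (auto simp: G21_def)
  have "V \<noteq> {0}"
    using V(2) by (metis dim_eq_0 order_refl zero_neq_one)
  moreover have "0 \<in> V"
    by (rule subspace_0[OF V(1)])
  ultimately obtain w where w: "w \<in> V" "w \<noteq> 0"
    by blast
  have "w /\<^sub>R norm w \<in> V \<and> norm (w /\<^sub>R norm w) = 1"
    using w subspace_scale[OF V(1)] by simp
  then have *: "line_dir V \<in> V \<and> norm (line_dir V) = 1"
    unfolding line_dir_def by (rule someI)
  then show "line_dir V \<in> V" "norm (line_dir V) = 1"
    by auto
  have "line_dir V \<noteq> 0"
    using * by auto
  then have "dim (span {line_dir V}) = 1"
    by simp
  then have "dim V \<le> dim (span {line_dir V})"
    using V(2) by simp
  moreover have "span {line_dir V} \<subseteq> V"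
    using * V(1) by (simp add: span_minimal)
  ultimately show "V = span {line_dir V}"
    by (metis subspace_dim_equal[OF subspace_span V(1)])
qed

lemma bij_betw_line_coord:
  assumes "V \<in> G21"
  shows "bij_betw (line_coord V) V UNIV"
    and "\<And>p q. p \<in> V \<Longrightarrow> q \<in> V \<Longrightarrow> dist (line_coord V p) (line_coord V q) = dist p q"
proof -
  note u = line_dir[OF assms]
  have uu: "line_dir V \<bullet> line_dir V = 1"
    using u(2) by (simp add: norm_eq_1)
  have coord: "p = line_coord V p *\<^sub>R line_dir V" if p: "p \<in> V" for p
  proof -
    obtain k where "p = k *\<^sub>R line_dir V"
      using p u(3) unfolding span_singleton by (metis imageE)
    then show ?thesis
      by (simp add: line_coord_def uu)
  qed
  show iso: "dist (line_coord V p) (line_coord V q) = dist p q" if "p \<in> V" "q \<in> V" for p q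
  proof -
    have "dist p q = dist (line_coord V p *\<^sub>R line_dir V) (line_coord V q *\<^sub>R line_dir V)"
      using coord[OF that(1)] coord[OF that(2)] by (rule arg_cong2)
    then show ?thesis
      by (simp add: u(2) dist_norm flip: scaleR_left.diff)
  qed
  show "bij_betw (line_coord V) V UNIV"
  proof (rule bij_betwI')
    show "line_coord V p = line_coord V q \<longleftrightarrow> p = q" if "p \<in> V" "q \<in> V" for p q
      using iso[OF that] by (metis dist_eq_0_iff)
    show "\<exists>p\<in>V. k = line_coord V p" for k
    proof
      show "k *\<^sub>R line_dir V \<in> V"
        using assms u(1) by (auto simp: G21_def subspace_scale)
      show "k = line_coord V (k *\<^sub>R line_dir V)"
        by (simp add: line_coord_def uu)
    qed
  qed auto
qed

lemma orth_proj:
  assumes "V \<in> G21"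
  shows "orth_proj V x \<in> V" "\<And>v. v \<in> V \<Longrightarrow> (x - orth_proj V x) \<bullet> v = 0"
    and "orth_proj V x = (x \<bullet> line_dir V) *\<^sub>R line_dir V"
proof -
  note u = line_dir[OF assms]
  have uu: "line_dir V \<bullet> line_dir V = 1"
    using u(2) by (simp add: norm_eq_1)
  let ?p = "(x \<bullet> line_dir V) *\<^sub>R line_dir V"
  have V: "subspace V"
    using assms by (simp add: G21_def)
  have p: "?p \<in> V \<and> (\<forall>v\<in>V. (x - ?p) \<bullet> v = 0)"
  proof (intro conjI ballI)
    show "?p \<in> V"
      using V u(1) by (rule subspace_scale)
    fix v assume "v \<in> V"
    then obtain k where "v = k *\<^sub>R line_dir V"
      using u(3) unfolding span_singleton by (metis imageE)
    then show "(x - ?p) \<bullet> v = 0"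
      by (simp add: inner_diff_left uu)
  qed
  have unique: "q = ?p" if q: "q \<in> V \<and> (\<forall>v\<in>V. (x - q) \<bullet> v = 0)" for q
  proof -
    have d: "q - ?p \<in> V"
      using V p q by (simp add: subspace_diff)
    have "(q - ?p) \<bullet> (q - ?p) = (x - ?p) \<bullet> (q - ?p) - (x - q) \<bullet> (q - ?p)"
      by (simp add: inner_diff_left)
    then have "(q - ?p) \<bullet> (q - ?p) = 0"
      using d p q by simp
    then show ?thesis
      by simp
  qed
  show eq: "orth_proj V x = ?p"
    unfolding orth_proj_def using p unique by (rule the_equality)
  show "orth_proj V x \<in> V"
    using p unfolding eq by blast
  show "(x - orth_proj V x) \<bullet> v = 0" if "v \<in> V" for v
    using p that unfolding eq by blast
qed

lemma arccos_abs_inner_triangle: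
  fixes u v w :: "'a::real_inner"
  assumes "norm u = 1" "norm v = 1" "norm w = 1"
  shows "arccos \<bar>u \<bullet> w\<bar> \<le> arccos \<bar>u \<bullet> v\<bar> + arccos \<bar>v \<bullet> w\<bar>"
proof -
  have main: "arccos \<bar>a \<bullet> c\<bar> \<le> arccos (a \<bullet> b) + arccos (b \<bullet> c)"
    if n: "norm a = 1" "norm b = 1" "norm c = 1" and pos: "a \<bullet> b \<ge> 0" "b \<bullet> c \<ge> 0" for a b c :: 'a
  proof -
    have one: "a \<bullet> a = 1" "b \<bullet> b = 1" "c \<bullet> c = 1"
      using n by (simp_all add: norm_eq_1)
    have le: "\<bar>a \<bullet> b\<bar> \<le> 1" "\<bar>b \<bullet> c\<bar> \<le> 1" "\<bar>a \<bullet> c\<bar> \<le> 1"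
      using Cauchy_Schwarz_ineq2[of a b] Cauchy_Schwarz_ineq2[of b c]
        Cauchy_Schwarz_ineq2[of a c] n by simp_all
    define p where "p = a - (a \<bullet> b) *\<^sub>R b"
    define q where "q = c - (b \<bullet> c) *\<^sub>R b"
    have "norm p = sqrt (1 - (a \<bullet> b)\<^sup>2)" "norm q = sqrt (1 - (b \<bullet> c)\<^sup>2)"
      unfolding norm_eq_sqrt_inner p_def q_def
      by (simp_all add: inner_diff_left inner_diff_right one power2_eq_square inner_commute)
    moreover have "p \<bullet> q = a \<bullet> c - (a \<bullet> b) * (b \<bullet> c)"
      unfolding p_def q_def
      by (simp add: inner_diff_left inner_diff_right one inner_commute)
    moreover have "- (norm p * norm q) \<le> p \<bullet> q"
      using Cauchy_Schwarz_ineq2[of p q] by linarith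
    moreover have "cos (arccos (a \<bullet> b) + arccos (b \<bullet> c)) =
        (a \<bullet> b) * (b \<bullet> c) - sqrt (1 - (a \<bullet> b)\<^sup>2) * sqrt (1 - (b \<bullet> c)\<^sup>2)"
      using le by (simp add: cos_add cos_arccos_abs sin_arccos_abs)
    ultimately have "cos (arccos (a \<bullet> b) + arccos (b \<bullet> c)) \<le> \<bar>a \<bullet> c\<bar>"
      by simp
    then have "arccos \<bar>a \<bullet> c\<bar> \<le> arccos (cos (arccos (a \<bullet> b) + arccos (b \<bullet> c)))"
      using le(3) by (intro arccos_le_arccos) auto
    also have "\<dots> = arccos (a \<bullet> b) + arccos (b \<bullet> c)"
      using le pos arccos_le_pi2[of "a \<bullet> b"] arccos_le_pi2[of "b \<bullet> c"]
        arccos_lbound[of "a \<bullet> b"] arccos_lbound[of "b \<bullet> c"]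
      by (intro arccos_cos) linarith+
    finally show ?thesis .
  qed
  define a where "a = (if u \<bullet> v \<ge> 0 then u else - u)"
  define c where "c = (if v \<bullet> w \<ge> 0 then w else - w)"
  have "arccos \<bar>a \<bullet> c\<bar> \<le> arccos (a \<bullet> v) + arccos (v \<bullet> c)"
    using assms by (intro main) (auto simp: a_def c_def)
  moreover have "\<bar>a \<bullet> c\<bar> = \<bar>u \<bullet> w\<bar>" "a \<bullet> v = \<bar>u \<bullet> v\<bar>" "v \<bullet> c = \<bar>v \<bullet> w\<bar>"
    by (auto simp: a_def c_def)
  ultimately show ?thesis
    by simp
qed

theorem Metric_space_G21: "Metric_space G21 acute_angle"
proof
  have le: "\<bar>line_dir V \<bullet> line_dir W\<bar> \<le> 1" if "V \<in> G21" "W \<in> G21" for V W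
    using Cauchy_Schwarz_ineq2[of "line_dir V" "line_dir W"] line_dir(2) that by simp
  show "0 \<le> acute_angle V W" for V W
    using le[of V W] by (auto simp: acute_angle_def intro!: arccos_lbound)
  show "acute_angle V W = acute_angle W V" for V W
    by (auto simp: acute_angle_def inner_commute)
  show "acute_angle V W = 0 \<longleftrightarrow> V = W" if VW: "V \<in> G21" "W \<in> G21" for V W
  proof
    assume "V = W"
    then show "acute_angle V W = 0"
      using VW line_dir(2)[of W] by (simp add: acute_angle_def norm_eq_1)
  next
    assume "acute_angle V W = 0"
    then have "arccos \<bar>line_dir V \<bullet> line_dir W\<bar> = 0"
      using VW by (simp add: acute_angle_def)
    then have "\<bar>line_dir V \<bullet> line_dir W\<bar> = 1"
      using le[OF VW] by (metis abs_idempotent cos_arccos_abs cos_zero)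
    then have "\<bar>line_dir V \<bullet> line_dir W\<bar> = norm (line_dir V) * norm (line_dir W)"
      using VW line_dir(2) by simp
    then have "line_dir V = line_dir W \<or> line_dir V = - line_dir W"
      using VW line_dir(2) norm_cauchy_schwarz_abs_eq[of "line_dir V" "line_dir W"] by auto
    moreover have "- line_dir W \<in> W" "- line_dir V \<in> V"
      using VW line_dir(1) by (simp_all add: G21_def subspace_neg)
    ultimately have "line_dir V \<in> W" "line_dir W \<in> V"
      using VW line_dir(1) by (metis minus_minus)+
    then have "span {line_dir V} \<subseteq> W" "span {line_dir W} \<subseteq> V"
      using VW by (simp_all add: G21_def span_minimal)
    then show "V = W"
      using VW line_dir(3) by blast
  qed
  show "acute_angle U W \<le> acute_angle U V + acute_angle V W"
    if "U \<in> G21" "V \<in> G21" "W \<in> G21" for U V W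
    using that line_dir(2) by (simp add: acute_angle_def arccos_abs_inner_triangle)
qed

end

theory Submission
  imports Defs "HOL-Real_Asymp.Real_Asymp"
begin

text \<open>
  A line of slope \<open>t\<close> maps a point \<open>(x, y)\<close> to a multiple of \<open>x + t y\<close>. Fix \<open>\<sigma> \<in> {s, t}\<close>, put
  \<open>\<kappa> = \<sigma> (1 - \<theta>)\<close>, and note \<open>(R / r)\<^sup>\<sigma> = r\<^sup>-\<^sup>\<kappa>\<close> whenever \<open>R = r\<^sup>\<theta>\<close>. A block with slope \<open>q\<close> consists of
  the \<open>n\<close> points \<open>(c + 8 r j - K\<^sup>j q, K\<^sup>j)\<close>, \<open>j < n\<close>, where \<open>16 n = r\<^sup>-\<^sup>\<kappa>\<close> and \<open>K\<close> exceeds \<open>1 / r\<close>; it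
  projects to the points \<open>c + 8 r j + K\<^sup>j (t - q)\<close>. If \<open>q\<close> is very close to \<open>t\<close>, these are \<open>n\<close> points
  separated at scale \<open>r\<close> in an interval of length at most \<open>r\<^sup>\<theta>\<close>, so using all rational \<open>q\<close> and all \<open>n\<close>
  gives the lower bound \<open>\<sigma>\<close> for every \<open>t\<close>. For arbitrary \<open>q\<close> the geometric growth of \<open>K\<^sup>j\<close> makes
  some initial points stay within \<open>O(r n)\<close> of \<open>c\<close>, at most one point is in transition, and the
  remaining ones are too far apart to meet a common unit ball; hence no scale sees more than
  \<open>O(r\<^sup>-\<^sup>\<kappa>)\<close> balls. If \<open>\<bar>t - q\<bar> \<ge> 1\<close> there are no initial points, so blocks made for one family of
  lines are invisible to the other. Widely spaced shifts \<open>c\<close> keep different blocks apart in all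
  projections with \<open>\<bar>t\<bar> \<le> 1\<close>.
\<close>

section \<open>Bounding covering numbers from above and below\<close>

lemma covering_number_le:
  assumes "finite F" "A \<subseteq> (\<Union>c\<in>F. cball c r)"
  shows "covering_number r A \<le> card F"
  unfolding covering_number_def using assms by (intro Least_le) blast

text \<open>A closed ball of radius \<open>r\<close> holds at most one point of a set with gaps
  above \<open>2 * r\<close>, so sending each point to the centre of a ball containing it is
  injective into an optimal cover.\<close>

lemma card_le_covering_number:
  fixes A :: "'a::euclidean_space set"
  assumes "bounded A" "r > 0" "Y \<subseteq> A"
    and sep: "\<And>y z. y \<in> Y \<Longrightarrow> z \<in> Y \<Longrightarrow> y \<noteq> z \<Longrightarrow> 2 * r < dist y z"
  shows "card Y \<le> covering_number r A"
proof -
  obtain F where F: "finite F" "card F = covering_number r A" "A \<subseteq> (\<Union>c\<in>F. cball c r)"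
    using covering_number_attained[OF assms(1,2)] by blast
  have "\<forall>y\<in>Y. \<exists>c\<in>F. dist c y \<le> r"
    using F(3) assms(3) by fastforce
  then obtain g where g: "\<And>y. y \<in> Y \<Longrightarrow> g y \<in> F \<and> dist (g y) y \<le> r"
    by metis
  have "inj_on g Y"
  proof (rule inj_onI, rule ccontr)
    fix y z assume yz: "y \<in> Y" "z \<in> Y" "g y = g z" "y \<noteq> z"
    have "dist y z \<le> dist (g y) y + dist (g z) z"
      using dist_triangle2[of y z "g y"] yz(3) by (simp add: dist_commute)
    then show False
      using sep[of y z] g[of y] g[of z] yz by fastforce
  qed
  then show ?thesis
    using F(1,2) g by (metis card_inj_on_le image_subsetI)
qed

text \<open>Centres spaced by \<open>r\<close> rather than \<open>2 * r\<close> suffice for the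
  estimates and allow each point to be assigned to the nearest centre on its left by a
  floor.\<close>

lemma interval_cover:
  fixes a b r :: real
  assumes "r > 0" "a \<le> b"
  obtains F where "finite F" "real (card F) \<le> (b - a) / r + 1" "{a..b} \<subseteq> (\<Union>c\<in>F. cball c r)"
proof
  define m where "m = nat \<lfloor>(b - a) / r\<rfloor>"
  let ?F = "(\<lambda>i. a + real i * r) ` {..m}"
  show "finite ?F"
    by simp
  have "card ?F \<le> Suc m"
    using card_image_le[of "{..m}" "\<lambda>i. a + real i * r"] by simp
  moreover have "real m \<le> (b - a) / r"
    using assms by (simp add: m_def)
  ultimately show "real (card ?F) \<le> (b - a) / r + 1"
    by linarith
  show "{a..b} \<subseteq> (\<Union>c\<in>?F. cball c r)"
  proof
    fix x assume x: "x \<in> {a..b}"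
    define i where "i = nat \<lfloor>(x - a) / r\<rfloor>"
    have i: "real i \<le> (x - a) / r" "(x - a) / r < real i + 1"
      using x assms by (simp_all add: i_def)
    have "i \<le> m"
      unfolding i_def m_def using x assms by (intro nat_mono floor_mono divide_right_mono) auto
    moreover have "dist (a + real i * r) x \<le> r"
      using i assms by (simp add: dist_real_def field_simps)
    ultimately show "x \<in> (\<Union>c\<in>?F. cball c r)"
      by auto
  qed
qed

section \<open>Covering numbers of one projected block\<close>

lemma power_gap:
  fixes K :: real
  assumes "8 \<le> K" "i < j"
  shows "K ^ i + 7 * K ^ i \<le> K ^ j"
proof -
  have "8 * K ^ i \<le> K ^ Suc i"
    using assms by (simp add: mult_right_mono)
  also have "\<dots> \<le> K ^ j"
    using assms by (intro power_increasing) auto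
  finally show ?thesis by simp
qed

text \<open>Here \<open>lam\<close> is the first coordinate of the direction of the line and
  \<open>\<tau>\<close> the slope of the line minus that of the block. The exponent
  \<open>\<kappa>\<close> belongs to the family of the block, \<open>\<kappa>'\<close> to that of
  the line; they may differ only if \<open>1 \<le> \<bar>\<tau>\<bar>\<close>.\<close>

lemma block_covering_number_le:
  fixes lam c r K \<tau> \<kappa> \<kappa>' \<rho> :: real and n :: nat
  defines "f \<equiv> \<lambda>j. lam * (c + 8 * r * real j + K ^ j * \<tau>)"
  assumes lam: "1/2 \<le> \<bar>lam\<bar>" "\<bar>lam\<bar> \<le> 1"
    and r: "0 < r" and \<kappa>: "0 < \<kappa>" "\<kappa> < 1" "16 * real n = r powr - \<kappa>" and rn: "16 * r * real n \<le> 1"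
    and K: "8 \<le> K" "1 / r \<le> K" and \<rho>: "0 < \<rho>" "\<rho> < 1" and \<kappa>': "0 < \<kappa>'"
    and A: "A \<subseteq> f ` {..<n}" "\<And>y z. y \<in> A \<Longrightarrow> z \<in> A \<Longrightarrow> \<bar>y - z\<bar> \<le> 2"
    and \<tau>: "1 \<le> \<bar>\<tau>\<bar> \<or> \<kappa> = \<kappa>'"
  shows "real (covering_number \<rho> A) \<le> 5 * \<rho> powr - \<kappa>'"
proof -
  define J where "J = {j. j < n \<and> f j \<in> A}"
  define high where "high = {j \<in> J. 1 \<le> K ^ j * \<bar>\<tau>\<bar>}"
  define mid where "mid = {j \<in> J. K ^ j * \<bar>\<tau>\<bar> < 1 \<and> 1 \<le> K ^ Suc j * \<bar>\<tau>\<bar>}"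
  define low where "low = {j \<in> J. K ^ Suc j * \<bar>\<tau>\<bar> < 1}"
  have fin: "finite high" "finite mid" "finite low"
    by (simp_all add: high_def mid_def low_def J_def)
  have "j \<in> high \<union> mid \<union> low" if "j \<in> J" for j
  proof -
    have "K ^ j * \<bar>\<tau>\<bar> < 1 \<and> 1 \<le> K ^ Suc j * \<bar>\<tau>\<bar> \<or> 1 \<le> K ^ j * \<bar>\<tau>\<bar> \<or> K ^ Suc j * \<bar>\<tau>\<bar> < 1"
      by linarith
    then show ?thesis
      using that unfolding high_def mid_def low_def by blast
  qed
  moreover have "A \<subseteq> f ` J"
    using A(1) unfolding J_def by blast
  ultimately have cover: "A \<subseteq> f ` high \<union> f ` mid \<union> f ` low"
    by blast
  have one: "1 \<le> \<rho> powr - \<kappa>'"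
    using \<rho> \<kappa>' powr_mono_both[of \<kappa>' 0 \<rho> \<rho>] by (simp add: powr_minus one_le_inverse_iff powr_le1)
  have high_sep: False if ij: "i \<in> high" "j \<in> high" "i < j" for i j
  proof -
    have "(K ^ i + 7 * K ^ i) * \<bar>\<tau>\<bar> \<le> K ^ j * \<bar>\<tau>\<bar>"
      using power_gap[OF K(1) ij(3)] by (intro mult_right_mono) auto
    then have "7 \<le> (K ^ j - K ^ i) * \<bar>\<tau>\<bar>"
      using ij(1) by (simp add: high_def algebra_simps)
    also have "\<dots> = \<bar>K ^ j * \<tau> - K ^ i * \<tau>\<bar>"
    proof -
      have "0 \<le> K ^ i"
        using K(1) by simp
      then have "0 \<le> K ^ j - K ^ i"
        using power_gap[OF K(1) ij(3)] by linarith
      then show ?thesis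
        by (simp add: abs_mult left_diff_distrib[symmetric])
    qed
    finally have 1: "7 \<le> \<bar>K ^ j * \<tau> - K ^ i * \<tau>\<bar>" .
    \<comment> \<open>By \<open>rn\<close> the linear terms differ by at most 1/2, so at least 6 of
      the gap 7 remains. The factor \<open>lam\<close> leaves at least 3, more than the distance 2
      allowed within \<open>A\<close>.\<close>
    have "8 * r * real j \<le> 8 * r * real n" "8 * r * real i \<le> 8 * r * real n"
      using ij r by (auto simp: high_def J_def)
    moreover have "0 \<le> 8 * r * real j" "0 \<le> 8 * r * real i"
      using r by auto
    ultimately have "6 \<le> \<bar>(8 * r * real j + K ^ j * \<tau>) - (8 * r * real i + K ^ i * \<tau>)\<bar>"
      using 1 rn by linarith
    then have "1/2 * 6 \<le> \<bar>lam\<bar> * \<bar>(8 * r * real j + K ^ j * \<tau>) - (8 * r * real i + K ^ i * \<tau>)\<bar>"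
      using lam by (intro mult_mono) auto
    also have "\<dots> = \<bar>f j - f i\<bar>"
      by (simp add: f_def abs_mult[symmetric] algebra_simps)
    finally show False
      using A(2)[of "f j" "f i"] ij by (simp add: high_def J_def)
  qed
  then have "card high \<le> 1"
    using fin(1) by (metis card_le_Suc0_iff_eq One_nat_def linorder_neqE_nat)
  then have ch: "card (f ` high) \<le> 1"
    using card_image_le[OF fin(1), of f] by linarith
  have mid_sep: False if ij: "i \<in> mid" "j \<in> mid" "i < j" for i j
  proof -
    have "K ^ Suc i * \<bar>\<tau>\<bar> \<le> K ^ j * \<bar>\<tau>\<bar>"
      using ij K by (intro mult_right_mono power_increasing) auto
    then show False
      using ij by (simp add: mid_def)
  qed
  then have "card mid \<le> 1"
    using fin(2) by (metis card_le_Suc0_iff_eq One_nat_def linorder_neqE_nat)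
  then have cm: "card (f ` mid) \<le> 1"
    using card_image_le[OF fin(2), of f] by linarith
  obtain F where F: "finite F" "real (card F) \<le> 2 * \<rho> powr - \<kappa>' + 1"
    "f ` low \<subseteq> (\<Union>c\<in>F. cball c \<rho>)"
  proof (cases "1 \<le> \<bar>\<tau>\<bar>")
    case True
    have "1 * 1 \<le> K ^ Suc j * \<bar>\<tau>\<bar>" for j
      using True K by (intro mult_mono one_le_power) auto
    then have "\<not> K ^ Suc j * \<bar>\<tau>\<bar> < 1" for j
      unfolding not_less mult_1 .
    then have "low = {}"
      unfolding low_def by blast
    then show ?thesis
      using that[of "{}"] by simp
  next
    case False
    then have eq: "\<kappa>' = \<kappa>"
      using \<tau> by simp
    show ?thesis
    \<comment> \<open>Up to scale \<open>r\<close> one ball per point is affordable; above it, the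
      short interval containing all these points is covered instead.\<close>
    proof (cases "\<rho> \<le> r")
      case True
      have "card (f ` low) \<le> card {..<n}"
        using card_image_le[OF fin(3), of f] card_mono[of "{..<n}" low]
        by (fastforce simp: low_def J_def)
      then have "real (card (f ` low)) \<le> r powr - \<kappa>"
        unfolding \<kappa>(3)[symmetric] by simp
      also have "\<dots> \<le> \<rho> powr - \<kappa>"
        using True \<rho> \<kappa> by (intro powr_mono2') auto
      finally have "real (card (f ` low)) \<le> \<rho> powr - \<kappa>" .
      moreover have "f ` low \<subseteq> (\<Union>c\<in>f ` low. cball c \<rho>)"
        using \<rho> by fastforce
      ultimately show ?thesis
        using that[of "f ` low"] fin(3) one eq by simp
    next
      case False
      have n: "1 \<le> real n" if "low \<noteq> {}"
        using that by (auto simp: low_def J_def)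
      have loc: "f j \<in> {lam * c - 9 * r * real n .. lam * c + 9 * r * real n}" if j: "j \<in> low" for j
      proof -
        \<comment> \<open>The bound at the next index improves the one at \<open>j\<close> by the
          factor \<open>1 / K \<le> r\<close>, so the perturbation is negligible against the linear
          terms.\<close>
        have "K * (K ^ j * \<bar>\<tau>\<bar>) < 1"
          using j by (simp add: low_def mult.assoc)
        moreover have "1 / r * (K ^ j * \<bar>\<tau>\<bar>) \<le> K * (K ^ j * \<bar>\<tau>\<bar>)"
          using K by (intro mult_right_mono) auto
        ultimately have "1 / r * (K ^ j * \<bar>\<tau>\<bar>) < 1"
          by linarith
        then have "K ^ j * \<bar>\<tau>\<bar> \<le> r"
          using r by (simp add: field_simps)
        also have "\<dots> \<le> r * real n"
          using n j r by auto
        finally have "\<bar>K ^ j * \<tau>\<bar> \<le> r * real n"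
          using K by (simp add: abs_mult)
        moreover have "8 * r * real j \<le> 8 * r * real n" "0 \<le> 8 * r * real j"
          using j r by (auto simp: low_def J_def)
        ultimately have "\<bar>8 * r * real j + K ^ j * \<tau>\<bar> \<le> 9 * r * real n"
          by linarith
        then have "\<bar>lam\<bar> * \<bar>8 * r * real j + K ^ j * \<tau>\<bar> \<le> 1 * (9 * r * real n)"
          using lam by (intro mult_mono) auto
        moreover have "f j - lam * c = lam * (8 * r * real j + K ^ j * \<tau>)"
          by (simp add: f_def algebra_simps)
        ultimately show ?thesis
          by (simp add: abs_mult[symmetric] abs_le_iff)
      qed
      have "0 \<le> 9 * r * real n"
        using r by simp
      then have "lam * c - 9 * r * real n \<le> lam * c + 9 * r * real n"
        by linarith
      then obtain F where F: "finite F"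
        "real (card F) \<le> (lam * c + 9 * r * real n - (lam * c - 9 * r * real n)) / \<rho> + 1"
        "{lam * c - 9 * r * real n .. lam * c + 9 * r * real n} \<subseteq> (\<Union>c\<in>F. cball c \<rho>)"
        by (rule interval_cover[OF \<rho>(1)])
      \<comment> \<open>The length of the interval is at most
        \<open>2 * r powr (1 - \<kappa>)\<close>. Since \<open>\<kappa> < 1\<close>, this power
        grows when \<open>r\<close> is replaced by the larger \<open>\<rho>\<close>.\<close>
      have "18 * (r * real n) \<le> 2 * (r * (16 * real n))"
        using r by simp
      also have "r * (16 * real n) = r powr (1 - \<kappa>)"
        unfolding \<kappa>(3) using r by (simp add: powr_diff powr_minus field_simps)
      also have "r powr (1 - \<kappa>) \<le> \<rho> powr (1 - \<kappa>)"
        using False r \<kappa> by (intro powr_mono2) auto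
      also have "\<rho> powr (1 - \<kappa>) = \<rho> * \<rho> powr - \<kappa>"
        using \<rho> by (simp add: powr_diff powr_minus field_simps)
      finally have "18 * (r * real n) / \<rho> \<le> 2 * \<rho> powr - \<kappa>"
        unfolding pos_divide_le_eq[OF \<rho>(1)] by (simp only: mult_ac)
      then have "real (card F) \<le> 2 * \<rho> powr - \<kappa>' + 1"
        using F(2) eq by simp
      moreover have "f ` low \<subseteq> (\<Union>c\<in>F. cball c \<rho>)"
        using loc F(3) by blast
      ultimately show ?thesis
        using that F(1) by blast
    qed
  qed
  let ?G = "f ` high \<union> f ` mid \<union> F"
  have "covering_number \<rho> A \<le> card ?G"
  proof (rule covering_number_le)
    show "finite ?G"
      using fin F by simp
    have self: "B \<subseteq> (\<Union>c\<in>B. cball c \<rho>)" for B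
      using \<rho> by force
    show "A \<subseteq> (\<Union>c\<in>?G. cball c \<rho>)"
      using cover Un_mono[OF Un_mono[OF self[of "f ` high"] self[of "f ` mid"]] F(3)]
      unfolding UN_Un by (rule order_trans)
  qed
  also have "\<dots> \<le> card (f ` high) + card (f ` mid) + card F"
    by (meson card_Un_le add_le_mono1 le_trans)
  \<comment> \<open>Each of the three ones is at most \<open>\<rho> powr - \<kappa>'\<close>, whence
    the constant 5.\<close>
  finally have "real (covering_number \<rho> A) \<le> 1 + 1 + (2 * \<rho> powr - \<kappa>' + 1)"
    using ch cm F(2) by linarith
  then show ?thesis
    using one by linarith
qed

text \<open>When \<open>\<tau>\<close> is tiny the projected block is almost an arithmetic
  progression: its gaps stay above \<open>2 * r\<close>, and its length is at most
  \<open>r powr (1 - \<kappa>)\<close>, so one ball of radius \<open>r powr \<theta>\<close>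
  contains it.\<close>

lemma le_covering_number_block:
  fixes lam c r K \<tau> \<kappa> \<theta> :: real and n :: nat
  defines "f \<equiv> \<lambda>j. lam * (c + 8 * r * real j + K ^ j * \<tau>)"
  assumes lam: "1/2 \<le> \<bar>lam\<bar>" "\<bar>lam\<bar> \<le> 1"
    and r: "0 < r" "r < 1" and \<kappa>: "16 * real n = r powr - \<kappa>" "\<theta> \<le> 1 - \<kappa>" and "0 < n"
    and \<tau>: "\<And>j. j < n \<Longrightarrow> \<bar>K ^ j * \<tau>\<bar> \<le> r / 2"
    and A: "f ` {..<n} \<subseteq> A"
  shows "n \<le> covering_number r (A \<inter> cball (f 0) (r powr \<theta>))"
proof -
  have dif: "f i - f j = lam * (8 * r * (real i - real j) + (K ^ i * \<tau> - K ^ j * \<tau>))" for i j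
    by (simp add: f_def algebra_simps)
  have sep: "2 * r < \<bar>f i - f j\<bar>" if "i < n" "j < n" "j < i" for i j
  proof -
    have "8 * r * 1 \<le> 8 * r * (real i - real j)"
      using that r by (intro mult_left_mono) auto
    then have "7 * r \<le> \<bar>8 * r * (real i - real j) + (K ^ i * \<tau> - K ^ j * \<tau>)\<bar>"
      using \<tau>[OF that(1)] \<tau>[OF that(2)] by linarith
    then have "1/2 * (7 * r) \<le> \<bar>lam\<bar> * \<bar>8 * r * (real i - real j) + (K ^ i * \<tau> - K ^ j * \<tau>)\<bar>"
      using lam r by (intro mult_mono) auto
    then show ?thesis
      using r unfolding dif abs_mult by linarith
  qed
  have sep': "2 * r < dist (f i) (f j)" if "i < n" "j < n" "i \<noteq> j" for i j
    using sep[of i j] sep[of j i] that by (auto simp: dist_real_def abs_minus_commute neq_iff)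
  have near: "f j \<in> cball (f 0) (r powr \<theta>)" if j: "j < n" for j
  proof -
    \<comment> \<open>As \<open>j + 1 \<le> n\<close>, there is a slack of at least
      \<open>r\<close>, which absorbs the two perturbations of size at most
      \<open>r / 2\<close>.\<close>
    have "8 * r * real j + r \<le> 8 * r * real n"
      using mult_left_mono[of "real j + 1" "real n" "8 * r"] j r by (simp add: algebra_simps)
    moreover have "0 \<le> 8 * r * real j"
      using r by simp
    ultimately have "\<bar>8 * r * (real j - real 0) + (K ^ j * \<tau> - K ^ 0 * \<tau>)\<bar> \<le> 8 * r * real n"
      using \<tau>[OF j] \<tau>[OF \<open>0 < n\<close>] by (simp only: of_nat_0 diff_zero)
    then have "\<bar>lam\<bar> * \<bar>8 * r * (real j - real 0) + (K ^ j * \<tau> - K ^ 0 * \<tau>)\<bar> \<le> 1 * (8 * r * real n)"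
      using lam by (intro mult_mono) auto
    then have "\<bar>f j - f 0\<bar> \<le> 8 * r * real n"
      unfolding dif abs_mult by simp
    also have "\<dots> \<le> r * (16 * real n)"
      using r by simp
    also have "\<dots> = r powr (1 - \<kappa>)"
      unfolding \<kappa> using r by (simp add: powr_diff powr_minus field_simps)
    also have "\<dots> \<le> r powr \<theta>"
      using r \<kappa> by (intro powr_mono') auto
    finally show ?thesis
      by (simp add: dist_real_def abs_minus_commute)
  qed
  have "inj_on f {..<n}"
    using sep' r by (intro inj_onI) (metis dist_self lessThan_iff mult_pos_pos not_less_iff_gr_or_eq zero_less_numeral)
  then have "n = card (f ` {..<n})"
    by (simp add: card_image)
  also have "\<dots> \<le> covering_number r (A \<inter> cball (f 0) (r powr \<theta>))"
  proof (rule card_le_covering_number)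
    show "bounded (A \<inter> cball (f 0) (r powr \<theta>))"
      by (simp add: bounded_Int)
    show "f ` {..<n} \<subseteq> A \<inter> cball (f 0) (r powr \<theta>)"
      using near A by auto
  qed (use r sep' in auto)
  finally show ?thesis .
qed


section \<open>Parameters and placement of the blocks\<close>

locale lacunary_blocks =
  fixes \<theta> :: real and \<sigma> :: "bool \<Rightarrow> real"
  assumes theta: "0 < \<theta>" "\<theta> < 1" and sigma: "0 < \<sigma> b" "\<sigma> b \<le> 1"
begin

definition kap :: "bool \<Rightarrow> real" where
  "kap b = \<sigma> b * (1 - \<theta>)"

text \<open>A block is indexed by its family (the sign of its slope), its number of points minus one,
  and a rational that becomes its slope after clamping to \<open>[1/2, 1]\<close>.\<close>

definition cnt :: "bool \<times> nat \<times> rat \<Rightarrow> nat" where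
  "cnt i = Suc (fst (snd i))"

text \<open>The integer number of points is prescribed and the scale solved for, so that
  \<open>16 * n = r powr - \<kappa>\<close> holds exactly, without rounding.\<close>

definition rad :: "bool \<times> nat \<times> rat \<Rightarrow> real" where
  "rad i = (16 * real (cnt i)) powr (- 1 / kap (fst i))"

definition ratio :: "bool \<times> nat \<times> rat \<Rightarrow> real" where
  "ratio i = 8 + 1 / rad i"

definition sgn_of :: "bool \<Rightarrow> real" where
  "sgn_of b = (if b then 1 else - 1)"

definition slope :: "bool \<times> nat \<times> rat \<Rightarrow> real" where
  "slope i = sgn_of (fst i) * max (1/2) (min 1 (of_rat (snd (snd i))))"

text \<open>Bounds how far the projection of a block reaches from its shift \<open>pos\<close>.\<close>

definition bnd :: "bool \<times> nat \<times> rat \<Rightarrow> real" where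
  "bnd i = 1 + 2 * ratio i ^ cnt i"

text \<open>The blocks are lined up along an enumeration of the countable index type. Each earlier
  code reserves twice the reach of its block plus 10, so the ranges of distinct blocks stay at least
  10 apart.\<close>

definition pos :: "bool \<times> nat \<times> rat \<Rightarrow> real" where
  "pos i = (\<Sum>k<to_nat i. 2 * (bnd (from_nat k) + 5)) + bnd i"

definition pt :: "bool \<times> nat \<times> rat \<Rightarrow> nat \<Rightarrow> real^2" where
  "pt i j = vector [pos i + 8 * rad i * real j - ratio i ^ j * slope i, ratio i ^ j]"

definition blocks :: "(real^2) set" where
  "blocks = {pt i j |i j. j < cnt i}"

section \<open>Parameter bounds and gaps between blocks\<close>

lemma kap: "0 < kap b" "kap b < 1" "\<theta> \<le> 1 - kap b"
proof -
  show "0 < kap b"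
    using theta sigma by (simp add: kap_def)
  \<comment> \<open>The hypothesis \<open>\<sigma> b \<le> 1\<close> is what makes a block short
    enough for a ball of radius \<open>rad i powr \<theta>\<close>.\<close>
  have "kap b \<le> 1 * (1 - \<theta>)"
    unfolding kap_def using theta sigma by (intro mult_right_mono) auto
  then show "kap b < 1" "\<theta> \<le> 1 - kap b"
    using theta by auto
qed

lemma cnt_eq_powr: "16 * real (cnt i) = rad i powr - kap (fst i)"
  using kap(1)[of "fst i"] by (simp add: rad_def powr_powr cnt_def)

lemma rad: "0 < rad i" "rad i < 1" "16 * rad i * real (cnt i) \<le> 1"
proof -
  show 0: "0 < rad i"
    by (simp add: rad_def cnt_def)
  have k: "0 < 1 / kap (fst i)"
    using kap(1) by simp
  have "1 powr (1 / kap (fst i)) < (16 * real (cnt i)) powr (1 / kap (fst i))"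
    by (rule powr_less_mono2) (use k in \<open>auto simp: cnt_def\<close>)
  then show 1: "rad i < 1"
    by (simp add: rad_def powr_minus inverse_less_1_iff)
  have "16 * rad i * real (cnt i) = rad i powr (1 - kap (fst i))"
    using cnt_eq_powr[of i] 0 by (simp add: powr_diff powr_minus field_simps)
  also have "\<dots> \<le> 1"
    using 0 1 kap(2)[of "fst i"] by (intro powr_le1) auto
  finally show "16 * rad i * real (cnt i) \<le> 1" .
qed

lemma ratio: "8 \<le> ratio i" "1 / rad i \<le> ratio i"
  using rad(1)[of i] by (simp_all add: ratio_def)

lemma slope: "1/2 \<le> sgn_of (fst i) * slope i" "sgn_of (fst i) * slope i \<le> 1" "\<bar>slope i\<bar> \<le> 1"
  by (auto simp: slope_def sgn_of_def)

lemma pt_nth: "pt i j $ 1 = pos i + 8 * rad i * real j - ratio i ^ j * slope i" "pt i j $ 2 = ratio i ^ j"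
  by (simp_all add: pt_def)

lemma inner_pt:
  assumes "u $ 1 \<noteq> 0"
  shows "pt i j \<bullet> u = u $ 1 * (pos i + 8 * rad i * real j + ratio i ^ j * (u $ 2 / u $ 1 - slope i))"
  using assms by (simp add: inner_vec_def sum_2 pt_nth field_simps)

lemma offset_le:
  assumes "j < cnt i" "\<bar>t\<bar> \<le> 1"
  shows "\<bar>8 * rad i * real j + ratio i ^ j * (t - slope i)\<bar> \<le> bnd i"
proof -
  have "8 * rad i * real j \<le> 8 * rad i * real (cnt i)"
    using assms rad(1)[of i] by simp
  moreover have "0 \<le> 8 * rad i * real (cnt i)" "0 \<le> 8 * rad i * real j"
    using rad(1)[of i] by simp_all
  ultimately have "8 * rad i * real j \<le> 1" "0 \<le> 8 * rad i * real j"
    using rad(3)[of i] by linarith+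
  moreover have "\<bar>ratio i ^ j * (t - slope i)\<bar> \<le> ratio i ^ cnt i * 2"
    unfolding abs_mult using assms slope(3)[of i] ratio(1)[of i]
    by (intro mult_mono) (auto simp: power_increasing)
  ultimately show ?thesis
    unfolding bnd_def by linarith
qed

lemma bnd_pos: "0 < bnd i"
  using ratio(1)[of i] by (simp add: bnd_def add_pos_nonneg)

lemma pos_gap:
  assumes "to_nat i < to_nat i'"
  shows "bnd i + bnd i' + 10 \<le> pos i' - pos i"
proof -
  let ?g = "\<lambda>k. 2 * (bnd (from_nat k :: bool \<times> nat \<times> rat) + 5)"
  have "sum ?g {..<Suc (to_nat i)} \<le> sum ?g {..<to_nat i'}"
    using assms less_imp_le[OF bnd_pos] by (intro sum_mono2) auto
  then show ?thesis
    by (simp add: pos_def)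
qed

lemma offset_gap:
  assumes "i \<noteq> i'" "j < cnt i" "j' < cnt i'" "\<bar>t\<bar> \<le> 1"
  shows "10 \<le> \<bar>(pos i + 8 * rad i * real j + ratio i ^ j * (t - slope i))
            - (pos i' + 8 * rad i' * real j' + ratio i' ^ j' * (t - slope i'))\<bar>"
proof -
  have "to_nat i \<noteq> to_nat i'"
    using assms(1) by simp
  then have "bnd i + bnd i' + 10 \<le> \<bar>pos i' - pos i\<bar>"
    using pos_gap[of i i'] pos_gap[of i' i] by (cases rule: linorder_cases[of "to_nat i" "to_nat i'"]) auto
  then show ?thesis
    using offset_le[OF assms(2,4)] offset_le[OF assms(3,4)] by linarith
qed

section \<open>Uniform discreteness and unboundedness\<close>

lemma uniform_discrete_blocks: "uniform_discrete blocks"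
  unfolding uniform_discrete_def
proof (intro exI[of _ 1] conjI ballI impI)
  fix x y assume "x \<in> blocks" "y \<in> blocks" and d: "dist x y < 1"
  then obtain i j i' j' where x: "x = pt i j" "j < cnt i" and y: "y = pt i' j'" "j' < cnt i'"
    unfolding blocks_def by blast
  have d': "\<bar>x $ k - y $ k\<bar> < 1" for k
    using d dist_vec_nth_le[of x k y] by (simp add: dist_real_def)
  \<comment> \<open>For slope 0 the projected position is the first coordinate, so distinct blocks
    already differ there by at least 10. Within one block the second coordinates, powers of
    \<open>ratio i\<close>, do the separating.\<close>
  have "i = i'"
    using offset_gap[OF _ x(2) y(2), of 0] d'[of 1] unfolding x y pt_nth by force
  have "1 \<le> \<bar>ratio i ^ a - ratio i ^ b\<bar>" if "b < a" for a b
  proof -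
    have "1 \<le> ratio i ^ b"
      using ratio(1)[of i] by (intro one_le_power) auto
    then show ?thesis
      using power_gap[OF ratio(1)[of i] that] by linarith
  qed
  then have "j = j'"
    using d'[of 2] unfolding x y pt_nth \<open>i = i'\<close>
    by (metis abs_minus_commute linorder_neqE_nat not_le)
  then show "x = y"
    using x y \<open>i = i'\<close> by simp
qed simp

lemma not_bounded_blocks: "\<not> bounded blocks"
proof
  assume "bounded blocks"
  then obtain B where B: "\<And>x. x \<in> blocks \<Longrightarrow> norm x \<le> B"
    unfolding bounded_iff by blast
  obtain l :: nat where l: "B < real l"
    using reals_Archimedean2 by blast
  define i where "i = (True, l, 0 :: rat)"
  \<comment> \<open>The last point of a block of \<open>l + 1\<close> points has height
    \<open>ratio i ^ l\<close>, which exceeds any bound as \<open>l\<close> grows.\<close>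
  have "real l < 2 ^ l"
    by (rule of_nat_less_two_power)
  also have "\<dots> \<le> ratio i ^ l"
    using ratio(1)[of i] by (intro power_mono) auto
  also have "\<dots> \<le> norm (pt i l)"
    using component_le_norm_cart[of "pt i l" 2] ratio(1)[of i] by (simp add: pt_nth)
  also have "\<dots> \<le> B"
    by (rule B) (auto simp: blocks_def cnt_def i_def)
  finally show False
    using l by simp
qed

section \<open>The Assouad spectrum of the projections\<close>

lemma scale_ratio:
  assumes "0 < r"
  shows "(r powr \<theta> / r) powr \<alpha> = (r powr - kap b) powr (\<alpha> / \<sigma> b)"
proof -
  have "r powr \<theta> / r = r powr (\<theta> - 1)"
    using assms by (simp add: powr_diff)
  \<comment> \<open>Writing the ratio through \<open>r powr - kap b\<close> suits both bounds: the
    outer exponent is 1 for \<open>\<alpha> = \<sigma> b\<close>, and at the scale of a block of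
    family \<open>b\<close> the base is \<open>16 * real (cnt i)\<close>.\<close>
  moreover have "- kap b * (\<alpha> / \<sigma> b) = (\<theta> - 1) * \<alpha>"
    using sigma(1)[of b] by (simp add: kap_def field_simps)
  ultimately show ?thesis
    by (simp only: powr_powr)
qed

lemma assouad_spectrum_inner_blocks:
  fixes u :: "real^2"
  assumes u: "1/2 \<le> \<bar>u $ 1\<bar>" "\<bar>u $ 1\<bar> \<le> 1"
    and t: "1/2 \<le> sgn_of b * (u $ 2 / u $ 1)" "sgn_of b * (u $ 2 / u $ 1) \<le> 1"
  shows "assouad_spectrum \<theta> ((\<lambda>x. x \<bullet> u) ` blocks) = \<sigma> b"
proof -
  define t where "t = u $ 2 / u $ 1"
  define f where "f i j = u $ 1 * (pos i + 8 * rad i * real j + ratio i ^ j * (t - slope i))" for i j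
  define Y where "Y = (\<lambda>x. x \<bullet> u) ` blocks"
  have u0: "u $ 1 \<noteq> 0"
    using u by auto
  have t1: "\<bar>t\<bar> \<le> 1"
    using t by (auto simp: t_def[symmetric] sgn_of_def split: if_splits)
  have Y: "Y = {f i j |i j. j < cnt i}"
  proof -
    have "f i j = pt i j \<bullet> u" for i j
      unfolding f_def t_def by (rule inner_pt[OF u0, symmetric])
    then show ?thesis
      unfolding Y_def blocks_def by (simp only:) blast
  qed
  have far: "2 < \<bar>f i j - f i' j'\<bar>" if "i \<noteq> i'" "j < cnt i" "j' < cnt i'" for i j i' j'
  proof -
    have "1/2 * 10 \<le> \<bar>u $ 1\<bar> * \<bar>(pos i + 8 * rad i * real j + ratio i ^ j * (t - slope i))
            - (pos i' + 8 * rad i' * real j' + ratio i' ^ j' * (t - slope i'))\<bar>"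
      using offset_gap[OF that t1] u by (intro mult_mono) auto
    then show ?thesis
      unfolding f_def abs_mult[symmetric] right_diff_distrib by linarith
  qed
  let ?S = "{\<alpha>. \<alpha> \<ge> 0 \<and> (\<exists>C>0. \<forall>R x. 0 < R \<and> R < 1 \<and> x \<in> Y \<longrightarrow>
     real (covering_number (R powr (1/\<theta>)) (Y \<inter> cball x R)) \<le> C * (R / R powr (1/\<theta>)) powr \<alpha>)}"
  \<comment> \<open>Upper bound: a ball of radius below 1 centred in \<open>Y\<close> meets a single
    block, because distinct blocks are more than 2 apart.\<close>
  have "\<sigma> b \<in> ?S"
  proof (intro CollectI conjI exI[of _ 5] allI impI)
    fix R x :: real assume Rx: "0 < R \<and> R < 1 \<and> x \<in> Y"
    then obtain i j where x: "x = f i j" "j < cnt i"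
      unfolding Y by blast
    define \<rho> where "\<rho> = R powr (1/\<theta>)"
    have \<rho>: "0 < \<rho>" "\<rho> < 1"
      using Rx theta powr_less_mono2[of "1/\<theta>" R 1] by (auto simp: \<rho>_def)
    have R: "R = \<rho> powr \<theta>"
      using Rx theta by (simp add: \<rho>_def powr_powr)
    have "real (covering_number \<rho> (Y \<inter> cball x R)) \<le> 5 * \<rho> powr - kap b"
    proof (rule block_covering_number_le[OF u rad(1) kap(1,2) cnt_eq_powr rad(3) ratio \<rho> kap(1)])
      show "Y \<inter> cball x R \<subseteq> (\<lambda>j. u $ 1 * (pos i + 8 * rad i * real j + ratio i ^ j * (t - slope i))) ` {..<cnt i}"
      proof
        fix y assume y: "y \<in> Y \<inter> cball x R"
        then obtain i' j' where y': "y = f i' j'" "j' < cnt i'"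
          unfolding Y by blast
        have "\<bar>x - y\<bar> \<le> 2"
          using y Rx by (simp add: dist_real_def)
        then have "i' = i"
          using far[OF _ x(2) y'(2)] unfolding x y' by force
        then show "y \<in> (\<lambda>j. u $ 1 * (pos i + 8 * rad i * real j + ratio i ^ j * (t - slope i))) ` {..<cnt i}"
          using y' unfolding f_def by blast
      qed
      show "\<bar>y - z\<bar> \<le> 2" if "y \<in> Y \<inter> cball x R" "z \<in> Y \<inter> cball x R" for y z
        using that Rx by (auto simp: dist_real_def)
      \<comment> \<open>For a block of the other family, \<open>t\<close> and \<open>slope i\<close>
        have opposite signs and absolute value at least 1/2 each.\<close>
      show "1 \<le> \<bar>t - slope i\<bar> \<or> kap (fst i) = kap b"
        using t slope(1)[of i] by (cases b; cases "fst i") (auto simp: sgn_of_def t_def[symmetric])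
    qed
    also have "\<rho> powr - kap b = (R / \<rho>) powr \<sigma> b"
      unfolding R scale_ratio[OF \<rho>(1), of _ b] using sigma(1)[of b] by simp
    finally show "real (covering_number (R powr (1/\<theta>)) (Y \<inter> cball x R)) \<le> 5 * (R / R powr (1/\<theta>)) powr \<sigma> b"
      unfolding \<rho>_def .
  qed (use sigma(1)[of b] in auto)
  \<comment> \<open>Lower bound: blocks of family \<open>b\<close> with slope close to
    \<open>t\<close> and arbitrarily many points force a linear function of \<open>l\<close> below a
    power with exponent \<open>e < 1\<close>.\<close>
  moreover have "\<sigma> b \<le> \<alpha>" if \<alpha>: "\<alpha> \<in> ?S" for \<alpha>
  proof (rule ccontr)
    assume "\<not> \<sigma> b \<le> \<alpha>"
    define e where "e = \<alpha> / \<sigma> b"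
    have e: "0 \<le> e" "e < 1"
      using \<alpha> \<open>\<not> \<sigma> b \<le> \<alpha>\<close> sigma(1)[of b] by (auto simp: e_def)
    obtain C where C: "C > 0" "\<And>R x. 0 < R \<Longrightarrow> R < 1 \<Longrightarrow> x \<in> Y \<Longrightarrow>
        real (covering_number (R powr (1/\<theta>)) (Y \<inter> cball x R)) \<le> C * (R / R powr (1/\<theta>)) powr \<alpha>"
      using \<alpha> by blast
    have le: "real (Suc l) \<le> C * (16 * real (Suc l)) powr e" for l
    proof -
      \<comment> \<open>The rational 0 is a placeholder: count, scale and ratio depend only on
        \<open>b\<close> and \<open>l\<close>, so the tolerance \<open>d\<close> can be fixed before
        \<open>q\<close> is chosen.\<close>
      define i0 where "i0 = (b, l, 0 :: rat)"
      define d where "d = rad i0 / 2 / ratio i0 ^ cnt i0"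
      have "0 < d"
        using rad(1)[of i0] ratio(1)[of i0] by (simp add: d_def)
      then obtain q where q: "\<bar>of_rat q - sgn_of b * t\<bar> < d"
        using of_rat_dense[of "sgn_of b * t - d" "sgn_of b * t + d"]
        by (metis abs_diff_less_iff less_add_same_cancel1 diff_less_eq less_trans)
      define i where "i = (b, l, q)"
      have i: "cnt i = Suc l" "fst i = b" "rad i = rad i0" "ratio i = ratio i0" "cnt i0 = cnt i"
        by (simp_all add: i_def i0_def cnt_def rad_def ratio_def)
      have "\<bar>t - slope i\<bar> = \<bar>max (1/2) (min 1 (of_rat q)) - sgn_of b * t\<bar>"
        by (auto simp: slope_def i_def sgn_of_def)
      \<comment> \<open>Clamping to the interval from 1/2 to 1 does not increase the distance to
        \<open>sgn_of b * t\<close>, which lies in that interval.\<close>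
      also have "\<dots> < d"
        using q t unfolding t_def[symmetric] by linarith
      finally have close: "\<bar>t - slope i\<bar> < d" .
      define R where "R = rad i powr \<theta>"
      have R: "0 < R" "R < 1" "R powr (1/\<theta>) = rad i"
        using rad(1,2)[of i] theta powr_less_mono2[of \<theta> "rad i" 1] by (auto simp: R_def powr_powr)
      have "cnt i \<le> covering_number (rad i) (Y \<inter> cball (u $ 1 * (pos i + 8 * rad i * real 0 + ratio i ^ 0 * (t - slope i))) (rad i powr \<theta>))"
      proof (rule le_covering_number_block[OF u rad(1,2) cnt_eq_powr kap(3)])
        show "0 < cnt i"
          by (simp add: cnt_def)
        show "\<bar>ratio i ^ j * (t - slope i)\<bar> \<le> rad i / 2" if "j < cnt i" for j
        proof -
          have "\<bar>ratio i ^ j * (t - slope i)\<bar> \<le> ratio i ^ cnt i * d"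
            unfolding abs_mult using close ratio(1)[of i] that
            by (intro mult_mono) (auto simp: power_increasing)
          also have "\<dots> = rad i / 2"
            using ratio(1)[of i0] by (simp add: d_def i)
          finally show ?thesis .
        qed
        show "(\<lambda>j. u $ 1 * (pos i + 8 * rad i * real j + ratio i ^ j * (t - slope i))) ` {..<cnt i} \<subseteq> Y"
          unfolding Y f_def by blast
      qed
      then have "real (Suc l) \<le> real (covering_number (R powr (1/\<theta>)) (Y \<inter> cball (f i 0) R))"
        unfolding R(3) unfolding i(1) f_def R_def by (simp only: of_nat_le_iff)
      also have "\<dots> \<le> C * (R / R powr (1/\<theta>)) powr \<alpha>"
      proof (rule C(2)[OF R(1,2)])
        have "0 < cnt i"
          by (simp add: cnt_def)
        then show "f i 0 \<in> Y"
          unfolding Y by blast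
      qed
      also have "(R / R powr (1/\<theta>)) powr \<alpha> = (16 * real (Suc l)) powr e"
        unfolding R(3) unfolding R_def scale_ratio[OF rad(1), of _ _ b] e_def
        using cnt_eq_powr[of i] by (simp only: i)
      finally show ?thesis .
    qed
    have "filterlim (\<lambda>l. real (Suc l) powr (1 - e)) at_top sequentially"
      using e by real_asymp
    then have "eventually (\<lambda>l. C * 16 powr e < real (Suc l) powr (1 - e)) sequentially"
      unfolding filterlim_at_top_dense by blast
    then obtain l where l: "C * 16 powr e < real (Suc l) powr (1 - e)"
      unfolding eventually_sequentially by blast
    have "real (Suc l) powr (1 - e) * real (Suc l) powr e \<le> C * 16 powr e * real (Suc l) powr e"
      using le[of l] by (simp add: powr_mult powr_add[symmetric] del: of_nat_Suc)
    then show False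
      using l by simp
  qed
  ultimately have "Inf ?S = \<sigma> b"
    by (intro cInf_eq_minimum) blast+
  then show ?thesis
    by (simp add: assouad_spectrum_def Y_def)
qed

end

section \<open>Lines with slope near 3/4 or -3/4\<close>

lemma proj_real_eq_inner:
  assumes "V \<in> G21"
  shows "proj_real V x = x \<bullet> line_dir V"
  using line_dir(2)[OF assms] by (simp add: proj_real_def line_coord_def orth_proj(3)[OF assms] norm_eq_1)

text \<open>The slope 3/4 is the midpoint of the interval from 1/2 to 1, and the triple 3, 4, 5
  gives a unit spanning vector with rational coordinates. A cosine bound then confines the slope by
  polynomial inequalities; the sign \<open>a\<close> selects the family.\<close>

lemma slope_near_line:
  fixes a :: real
  assumes a: "\<bar>a\<bar> = 1"
  defines "V0 \<equiv> span {vector [4/5, a * 3/5] :: real^2}"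
  shows "V0 \<in> G21"
    and "\<And>V. V \<in> Metric_space.mball G21 acute_angle V0 (arccos (999/1000)) \<Longrightarrow>
      V \<in> G21 \<and> 1/2 \<le> \<bar>line_dir V $ 1\<bar> \<and> \<bar>line_dir V $ 1\<bar> \<le> 1 \<and>
      1/2 \<le> a * (line_dir V $ 2 / line_dir V $ 1) \<and> a * (line_dir V $ 2 / line_dir V $ 1) \<le> 1"
proof -
  let ?v = "vector [4/5, a * 3/5] :: real^2"
  have aa: "a * a = 1"
    using a by (metis abs_mult_self_eq mult_1)
  have v: "norm ?v = 1"
    using aa by (simp add: norm_eq_1 inner_vec_def sum_2)
  then have "?v \<noteq> 0"
    by (metis norm_zero zero_neq_one)
  then show G: "V0 \<in> G21"
    unfolding V0_def G21_def by simp
  interpret Metric_space G21 acute_angle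
    by (rule Metric_space_G21)
  fix V assume "V \<in> mball V0 (arccos (999/1000))"
  then have V: "V \<in> G21" and ang: "arccos \<bar>line_dir V0 \<bullet> line_dir V\<bar> < arccos (999/1000)"
    using G by (auto simp: in_mball acute_angle_def)
  define w where "w = line_dir V"
  have w: "norm w = 1"
    using line_dir(2)[OF V] by (simp add: w_def)
  \<comment> \<open>The chosen direction of \<open>V0\<close> is known only up to sign, which the
    absolute value removes.\<close>
  obtain k where k: "line_dir V0 = k *\<^sub>R ?v"
    using line_dir(1)[OF G] unfolding V0_def span_singleton by blast
  have "\<bar>k\<bar> = 1"
    using line_dir(2)[OF G] v unfolding k by simp
  then have "\<bar>line_dir V0 \<bullet> line_dir V\<bar> = \<bar>?v \<bullet> w\<bar>"
    by (simp add: k w_def abs_mult)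
  moreover have "\<bar>?v \<bullet> w\<bar> \<le> 1"
    using Cauchy_Schwarz_ineq2[of ?v w] v w by simp
  ultimately have big: "999/1000 < \<bar>?v \<bullet> w\<bar>"
    using ang arccos_less_mono[of "\<bar>?v \<bullet> w\<bar>" "999/1000"] by simp
  define p where "p = w $ 1"
  define q where "q = a * w $ 2"
  have "?v \<bullet> w = (4 * p + 3 * q) / 5"
    by (simp add: inner_vec_def sum_2 p_def q_def)
  then have b: "999/200 < \<bar>4 * p + 3 * q\<bar>"
    using big by (simp only: abs_divide abs_numeral) simp
  have "q * q = w $ 2 * w $ 2"
    using aa by (simp add: q_def algebra_simps)
  then have n: "p * p + q * q = 1"
    using w by (simp add: norm_eq_1 inner_vec_def sum_2 p_def)
  \<comment> \<open>Up to the factor 5 and reflection by \<open>a\<close>, these are the components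
    of \<open>w\<close> along and across \<open>?v\<close>; a large first one makes the second
    small, so \<open>q / p\<close> is near 3/4.\<close>
  have "(4 * p + 3 * q)\<^sup>2 + (3 * p - 4 * q)\<^sup>2 = 25"
    using n by (simp add: power2_eq_square algebra_simps)
  moreover have "(999/200)\<^sup>2 < (4 * p + 3 * q)\<^sup>2"
    using b by (metis abs_le_square_iff abs_numeral abs_divide not_le)
  ultimately have "(3 * p - 4 * q)\<^sup>2 < (1/4)\<^sup>2"
    by (simp add: power2_eq_square)
  then have s: "\<bar>3 * p - 4 * q\<bar> < 1/4"
    by (metis abs_le_square_iff abs_1 abs_numeral abs_divide not_le)
  have pq: "1/2 \<le> \<bar>p\<bar> \<and> \<bar>p\<bar> \<le> 2 * \<bar>q\<bar> \<and> \<bar>q\<bar> \<le> \<bar>p\<bar> \<and> 0 \<le> q * p"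
    using b s by (auto simp: zero_le_mult_iff abs_if split: if_splits)
  have "\<bar>p\<bar> \<le> 1"
    using component_le_norm_cart[of w 1] w by (simp add: p_def)
  moreover have "q / p = \<bar>q\<bar> / \<bar>p\<bar>"
    using pq by (auto simp: zero_le_mult_iff)
  ultimately have "1/2 \<le> \<bar>p\<bar>" "\<bar>p\<bar> \<le> 1" "1/2 \<le> q / p" "q / p \<le> 1"
    using pq by (auto simp: field_simps)
  then show "V \<in> G21 \<and> 1/2 \<le> \<bar>line_dir V $ 1\<bar> \<and> \<bar>line_dir V $ 1\<bar> \<le> 1 \<and>
      1/2 \<le> a * (line_dir V $ 2 / line_dir V $ 1) \<and> a * (line_dir V $ 2 / line_dir V $ 1) \<le> 1"
    using V by (simp add: p_def q_def w_def)
qed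

theorem theorem2p7:
  fixes \<theta> s t :: real
  assumes "0 < \<theta>" and "\<theta> < 1"
    and "0 < s" and "s \<le> 1"
    and "0 < t" and "t \<le> 1"
  shows "\<exists>(X :: (real^2) set) I\<^sub>s I\<^sub>t.
      uniform_discrete X \<and> \<not> bounded X \<and>
      openin G21_topology I\<^sub>s \<and> openin G21_topology I\<^sub>t \<and>
      I\<^sub>s \<noteq> {} \<and> I\<^sub>t \<noteq> {} \<and> I\<^sub>s \<inter> I\<^sub>t = {} \<and>
      (\<forall>V\<in>I\<^sub>s. assouad_spectrum \<theta> (proj_real V ` X) = s) \<and>
      (\<forall>V\<in>I\<^sub>t. assouad_spectrum \<theta> (proj_real V ` X) = t)"
proof -
  \<comment> \<open>\<open>True\<close> labels the family for \<open>s\<close>, with positive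
    slopes, and \<open>False\<close> that for \<open>t\<close>, with negative slopes.\<close>
  interpret lacunary_blocks \<theta> "\<lambda>b. if b then s else t"
    using assms by unfold_locales auto
  interpret G: Metric_space G21 acute_angle
    by (rule Metric_space_G21)
  define V0 where "V0 b = span {vector [4/5, sgn_of b * 3/5] :: real^2}" for b
  define I where "I b = G.mball (V0 b) (arccos (999/1000))" for b
  have a: "\<bar>sgn_of b\<bar> = 1" for b
    by (simp add: sgn_of_def)
  have near: "V \<in> G21" "1/2 \<le> \<bar>line_dir V $ 1\<bar>" "\<bar>line_dir V $ 1\<bar> \<le> 1"
      "1/2 \<le> sgn_of b * (line_dir V $ 2 / line_dir V $ 1)" "sgn_of b * (line_dir V $ 2 / line_dir V $ 1) \<le> 1"
    if "V \<in> I b" for V b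
    using slope_near_line(2)[OF a, of V b] that by (simp_all add: I_def V0_def)
  have spec: "assouad_spectrum \<theta> (proj_real V ` blocks) = (if b then s else t)" if "V \<in> I b" for V b
  proof -
    have "proj_real V = (\<lambda>x. x \<bullet> line_dir V)"
      using proj_real_eq_inner[OF near(1)[OF that]] by blast
    then show ?thesis
      using assouad_spectrum_inner_blocks[OF near(2-5)[OF that]] by simp
  qed
  have "0 < arccos (999/1000)"
    using arccos_less_arccos[of "999/1000" 1] by simp
  then have ne: "I b \<noteq> {}" for b
    using slope_near_line(1)[OF a, of b] unfolding I_def V0_def by (metis G.centre_in_mball_iff empty_iff)
  have op: "openin G21_topology (I b)" for b
    unfolding I_def G21_topology_def by (rule G.openin_mball)
  \<comment> \<open>The slope of a line in \<open>I True\<close> is at least 1/2, that of a line in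
    \<open>I False\<close> at most -1/2.\<close>
  have "V \<notin> I False" if "V \<in> I True" for V
    using near(4)[of V True] near(4)[of V False] that by (auto simp: sgn_of_def)
  then have "I True \<inter> I False = {}"
    by blast
  then show ?thesis
    using uniform_discrete_blocks not_bounded_blocks op[of True] op[of False] ne[of True] ne[of False]
      spec[of _ True] spec[of _ False]
    by (intro exI[of _ blocks] exI[of _ "I True"] exI[of _ "I False"]) simp
qed

end
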